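(* Let $w_1,\dots,w_m,\widetilde{w}_1,\dots,\widetilde{w}_m\in\mathbb{R}^n$ and $\mathcal{E},\widetilde{\mathcal{E}}\in\mathbb{R}$. If the constraints $$\mathbf 1^T M\mathfrak{r}_i=0\ \text{ for all } i\in\{1,\dots,m\},\qquad\sum_{i=1}^m w_i^T M\mathfrak{r}_i=\mathcal{E},\qquad\sum_{i=1}^m\widetilde{w}_i^T M\mathfrak{r}_i=\widetilde{\mathcal{E}}$$ on $\mathfrak{r}=(\mathfrak{r}_1,\dots,\mathfrak{r}_m)\in(\mathbb{R}^n)^m$ do not contradict each other (in the sense explained in the context), then the unique solution $\mathfrak{r}=(\mathfrak{r}_1,\dots,\mathfrak{r}_m)$ of the problem of minimizing $\frac12\|\mathfrak{r}\|_M^2=\frac12\sum_{i=1}^m\mathfrak{r}_i^T M\mathfrak{r}_i$ subject to these constraints is given by $$\mathfrak{r}_i=\alpha\left(w_i-\frac{\mathbf 1^T M w_i}{\mathbf 1^T M\mathbf 1}\,\mathbf 1\right)+\widetilde{\alpha}\left(\widetilde{w}_i-\frac{\mathbf 1^T M\widetilde{w}_i}{\mathbf 1^T M\mathbf 1}\,\mathbf 1\right),\quad i\in\{1,\dots,m\},$$ where $$\begin{pmatrix}\alpha\\\widetilde{\alpha}\end{pmatrix}=\begin{pmatrix}\sum_{i}\left(w_i^T M w_i-\frac{(\mathbf 1^T M w_i)(\mathbf 1^T M w_i)}{\mathbf 1^T M\mathbf 1}\right)&\sum_{i}\left(w_i^T M\widetilde{w}_i-\frac{(\mathbf 1^T M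 w_i)(\mathbf 1^T M\widetilde{w}_i)}{\mathbf 1^T M\mathbf 1}\right)\\[1ex]\sum_{i}\left(\widetilde{w}_i^T M w_i-\frac{(\mathbf 1^T M\widetilde{w}_i)(\mathbf 1^T M w_i)}{\mathbf 1^T M\mathbf 1}\right)&\sum_{i}\left(\widetilde{w}_i^T M\widetilde{w}_i-\frac{(\mathbf 1^T M\widetilde{w}_i)(\mathbf 1^T M\widetilde{w}_i)}{\mathbf 1^T M\mathbf 1}\right)\end{pmatrix}^{-1}\begin{pmatrix}\mathcal{E}\\\widetilde{\mathcal{E}}\end{pmatrix}$$ (all sums over $i=1,\dots,m$).
   Context: $M\in\mathbb{R}^{n\times n}$ is a symmetric positive definite (diagonal) mass matrix on an element with $n$ nodes, and $\mathbf 1\in\mathbb{R}^n$ is the vector all of whose entries are $1$. The phrase "the constraints do not contradict each other" is used to express that the minimization problem has a unique solution; to make this more precise, it is assumed that $w=(w_1,\dots,w_m)$ is not constant on the element (that is, not all $w_i$ are multiples of $\mathbf 1$). In the application, $\mathfrak{r}_i$ is a correction added to the semidiscrete time derivative of the $i$-th conserved variable, and the constraint $\mathbf 1^T M\mathfrak{r}_i=0$ expresses that the correction preserves local conservation; $w_i$ contains the nodal values of the $i$-th entropy variable and $\widetilde{w}_i$ those of a second family of variables (e.g. derivatives of the kinetic energy with respect to the conserved variables), and $\mathcal{E},\widetilde{\mathcal{E}}$ are the differences between the desired and current values of the corresponding linear functionals of the time derivative.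
   Formalization: The 2×2 matrix can be singular under the stated assumptions (e.g. w̃ = w, Ẽ = E), so the inverse formula is stated when the matrix is invertible; in general, the linear system for (α, α̃) is shown to be solvable and each of its solutions gives the unique minimizer. *)

theory Defs
  imports "HOL-Analysis.Analysis"
begin

text \<open>Families \<open>(r\<^sub>1, \<dots>, r\<^sub>m)\<close> of nodal vectors in \<open>\<real>\<^sup>n\<close> have type \<open>real ^ 'n ^ 'm\<close>, with \<open>r $ i\<close>
  the \<open>i\<close>-th member. The numeral \<open>1 :: real ^ 'n\<close> is the vector all of whose entries are 1.\<close>

definition sym_pos_def :: "real ^ 'n ^ 'n \<Rightarrow> bool" where
  "sym_pos_def M \<longleftrightarrow> transpose M = M \<and> (\<forall>x. x \<noteq> 0 \<longrightarrow> 0 < x \<bullet> (M *v x))"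

definition mprod :: "real ^ 'n ^ 'n \<Rightarrow> real ^ 'n \<Rightarrow> real ^ 'n \<Rightarrow> real" where
  "mprod M u v = u \<bullet> (M *v v)"

definition constraints ::
  "real ^ 'n ^ 'n \<Rightarrow> real ^ 'n ^ 'm \<Rightarrow> real ^ 'n ^ 'm \<Rightarrow> real \<Rightarrow> real \<Rightarrow> real ^ 'n ^ 'm \<Rightarrow> bool" where
  "constraints M w w' E E' r \<longleftrightarrow>
     (\<forall>i. mprod M 1 (r $ i) = 0) \<and>
     (\<Sum>i\<in>UNIV. mprod M (w $ i) (r $ i)) = E \<and>
     (\<Sum>i\<in>UNIV. mprod M (w' $ i) (r $ i)) = E'"

definition objective :: "real ^ 'n ^ 'n \<Rightarrow> real ^ 'n ^ 'm \<Rightarrow> real" where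
  "objective M r = 1 / 2 * (\<Sum>i\<in>UNIV. mprod M (r $ i) (r $ i))"

definition is_solution ::
  "real ^ 'n ^ 'n \<Rightarrow> real ^ 'n ^ 'm \<Rightarrow> real ^ 'n ^ 'm \<Rightarrow> real \<Rightarrow> real \<Rightarrow> real ^ 'n ^ 'm \<Rightarrow> bool" where
  "is_solution M w w' E E' r \<longleftrightarrow> is_arg_min (objective M) (constraints M w w' E E') r"

definition constant_on_element :: "real ^ 'n ^ 'm \<Rightarrow> bool" where
  "constant_on_element w \<longleftrightarrow> (\<forall>i. \<exists>c. w $ i = c *\<^sub>R 1)"

text \<open>The sense in which the constraints ``do not contradict each other''. This does not exclude
  that \<^term>\<open>w'\<close> is, modulo constants, a multiple of \<^term>\<open>w\<close> (with a matching \<^term>\<open>E'\<close>);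
  the matrix \<open>gram_matrix\<close> below is then singular.\<close>

definition constraints_compatible ::
  "real ^ 'n ^ 'n \<Rightarrow> real ^ 'n ^ 'm \<Rightarrow> real ^ 'n ^ 'm \<Rightarrow> real \<Rightarrow> real \<Rightarrow> bool" where
  "constraints_compatible M w w' E E' \<longleftrightarrow>
     (\<exists>!r. is_solution M w w' E E' r) \<and> \<not> constant_on_element w"

definition gram_entry :: "real ^ 'n ^ 'n \<Rightarrow> real ^ 'n ^ 'm \<Rightarrow> real ^ 'n ^ 'm \<Rightarrow> real" where
  "gram_entry M u v =
     (\<Sum>i\<in>UNIV. mprod M (u $ i) (v $ i) - mprod M 1 (u $ i) * mprod M 1 (v $ i) / mprod M 1 1)"

definition gram_matrix ::
  "real ^ 'n ^ 'n \<Rightarrow> real ^ 'n ^ 'm \<Rightarrow> real ^ 'n ^ 'm \<Rightarrow> real ^ 2 ^ 2" where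
  "gram_matrix M w w' =
     vector [vector [gram_entry M w w, gram_entry M w w'],
             vector [gram_entry M w' w, gram_entry M w' w']]"

definition correction ::
  "real ^ 'n ^ 'n \<Rightarrow> real ^ 'n ^ 'm \<Rightarrow> real ^ 'n ^ 'm \<Rightarrow> real ^ 2 \<Rightarrow> real ^ 'n ^ 'm" where
  "correction M w w' a =
     (\<chi> i. (a $ 1) *\<^sub>R (w $ i - (mprod M 1 (w $ i) / mprod M 1 1) *\<^sub>R 1) +
           (a $ 2) *\<^sub>R (w' $ i - (mprod M 1 (w' $ i) / mprod M 1 1) *\<^sub>R 1))"

end

theory Submission
  imports Defs
begin

text \<open>On families with \<open>1\<^sup>T M r\<^sub>i = 0\<close>, the remaining two constraints are \<open>\<langle>p, r\<rangle> = E\<close> and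
  \<open>\<langle>q, r\<rangle> = E'\<close>, where \<open>p\<close>, \<open>q\<close> are the projections of \<open>w\<close>, \<open>w'\<close> orthogonal to the constants
  and \<open>\<langle>u, v\<rangle> = \<Sum>\<^sub>i u\<^sub>i\<^sup>T M v\<^sub>i\<close>. The Gram matrix of \<open>p\<close>, \<open>q\<close> expresses feasibility of
  \<open>c = a\<^sub>1 p + a\<^sub>2 q\<close>, and every feasible \<open>r\<close> has \<open>r - c\<close> orthogonal to \<open>p\<close> and \<open>q\<close>, hence to \<open>c\<close>;
  Pythagoras makes \<open>c\<close> the unique minimizer. Solvability of the Gram system for singular Gram
  matrices follows from the existence of a feasible point: then \<open>q\<close> is a multiple of \<open>p \<noteq> 0\<close>.\<close>

definition fprod :: "real ^ 'n ^ 'n \<Rightarrow> real ^ 'n ^ 'm \<Rightarrow> real ^ 'n ^ 'm \<Rightarrow> real" where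
  "fprod M u v = (\<Sum>i\<in>UNIV. mprod M (u $ i) (v $ i))"

definition centered :: "real ^ 'n ^ 'n \<Rightarrow> real ^ 'n ^ 'm \<Rightarrow> real ^ 'n ^ 'm" where
  "centered M u = (\<chi> i. u $ i - (mprod M 1 (u $ i) / mprod M 1 1) *\<^sub>R 1)"

lemma mprod_add_left: "mprod M (u + v) x = mprod M u x + mprod M v x"
  and mprod_diff_left: "mprod M (u - v) x = mprod M u x - mprod M v x"
  and mprod_scaleR_left: "mprod M (c *\<^sub>R u) x = c * mprod M u x"
  and mprod_add_right: "mprod M x (u + v) = mprod M x u + mprod M x v"
  and mprod_diff_right: "mprod M x (u - v) = mprod M x u - mprod M x v"
  and mprod_scaleR_right: "mprod M x (c *\<^sub>R u) = c * mprod M x u"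
  by (simp_all add: mprod_def inner_add_left inner_diff_left inner_add_right inner_diff_right
      matrix_vector_right_distrib matrix_vector_mult_diff_distrib matrix_vector_mult_scaleR)

lemmas mprod_linear = mprod_add_left mprod_diff_left mprod_scaleR_left
  mprod_add_right mprod_diff_right mprod_scaleR_right

lemma fprod_add_left: "fprod M (u + v) x = fprod M u x + fprod M v x"
  and fprod_diff_left: "fprod M (u - v) x = fprod M u x - fprod M v x"
  and fprod_scaleR_left: "fprod M (c *\<^sub>R u) x = c * fprod M u x"
  and fprod_add_right: "fprod M x (u + v) = fprod M x u + fprod M x v"
  and fprod_diff_right: "fprod M x (u - v) = fprod M x u - fprod M x v"
  and fprod_scaleR_right: "fprod M x (c *\<^sub>R u) = c * fprod M x u"
  by (simp_all add: fprod_def mprod_linear sum.distrib sum_subtractf sum_distrib_left)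

lemmas fprod_linear = fprod_add_left fprod_diff_left fprod_scaleR_left
  fprod_add_right fprod_diff_right fprod_scaleR_right

lemma mprod_commute:
  assumes "sym_pos_def M"
  shows "mprod M u v = mprod M v u"
  using assms unfolding mprod_def sym_pos_def_def
  by (metis dot_lmul_matrix inner_commute transpose_matrix_vector)

lemma mprod_pos:
  assumes "sym_pos_def M" "u \<noteq> 0"
  shows "0 < mprod M u u"
  using assms by (simp add: mprod_def sym_pos_def_def)

lemma mprod_nonneg:
  assumes "sym_pos_def M"
  shows "0 \<le> mprod M u u"
  using mprod_pos[OF assms, of u] by (cases "u = 0") (auto simp: mprod_def)

lemma mprod_one_one_pos:
  fixes M :: "real ^ 'n ^ 'n"
  assumes "sym_pos_def M"
  shows "0 < mprod M 1 1"
  using assms by (simp add: mprod_pos)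

lemma fprod_commute:
  assumes "sym_pos_def M"
  shows "fprod M u v = fprod M v u"
  unfolding fprod_def by (rule sum.cong[OF refl mprod_commute[OF assms]])

lemma fprod_nonneg:
  assumes "sym_pos_def M"
  shows "0 \<le> fprod M u u"
  unfolding fprod_def by (intro sum_nonneg mprod_nonneg assms)

lemma fprod_eq_0_iff:
  assumes "sym_pos_def M"
  shows "fprod M u u = 0 \<longleftrightarrow> u = 0"
proof
  assume "fprod M u u = 0"
  then have "\<forall>i. mprod M (u $ i) (u $ i) = 0"
    unfolding fprod_def by (subst (asm) sum_nonneg_eq_0_iff) (auto simp: mprod_nonneg assms)
  then show "u = 0"
    using mprod_pos[OF assms] by (simp add: vec_eq_iff[of u]) (metis less_irrefl)
qed (simp add: fprod_def mprod_def)

lemma mprod_one_centered: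
  assumes "sym_pos_def M"
  shows "mprod M 1 (centered M u $ i) = 0"
  using mprod_one_one_pos[OF assms] by (simp add: centered_def mprod_linear)

text \<open>Centering changes each member by a multiple of \<open>1\<close>, to which every
  \<open>r $ i\<close> is \<open>M\<close>-orthogonal.\<close>

lemma fprod_centered_left:
  assumes "\<And>i. mprod M 1 (r $ i) = 0"
  shows "fprod M (centered M u) r = fprod M u r"
  by (simp add: fprod_def centered_def mprod_linear assms)

text \<open>Once the right factor is centered, centering the left one has no effect; expanding the
  single remaining projection produces the product subtracted in \<open>gram_entry\<close>.\<close>

lemma gram_entry_eq_fprod:
  assumes "sym_pos_def M"
  shows "gram_entry M u v = fprod M (centered M u) (centered M v)"
proof -
  have "fprod M (centered M u) (centered M v) = fprod M u (centered M v)"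
    by (rule fprod_centered_left) (rule mprod_one_centered[OF assms])
  also have "\<dots> = gram_entry M u v"
    unfolding fprod_def gram_entry_def
  proof (rule sum.cong[OF refl])
    fix i
    show "mprod M (u $ i) (centered M v $ i) =
        mprod M (u $ i) (v $ i) - mprod M 1 (u $ i) * mprod M 1 (v $ i) / mprod M 1 1"
      using mprod_commute[OF assms, of "u $ i" 1] by (simp add: centered_def mprod_linear)
  qed
  finally show ?thesis by simp
qed

lemma constraints_iff_fprod:
  "constraints M w w' E E' r \<longleftrightarrow>
     (\<forall>i. mprod M 1 (r $ i) = 0) \<and>
     fprod M (centered M w) r = E \<and> fprod M (centered M w') r = E'"
proof (cases "\<forall>i. mprod M 1 (r $ i) = 0")
  case True
  then show ?thesis
    by (simp add: constraints_def fprod_centered_left) (simp add: fprod_def)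
qed (auto simp: constraints_def)

lemma correction_eq_centered:
  "correction M w w' a = (a $ 1) *\<^sub>R centered M w + (a $ 2) *\<^sub>R centered M w'"
  by (simp add: vec_eq_iff correction_def centered_def)

lemma gram_system_iff:
  "gram_matrix M w w' *v a = vector [E, E'] \<longleftrightarrow>
     gram_entry M w w * a $ 1 + gram_entry M w w' * a $ 2 = E \<and>
     gram_entry M w' w * a $ 1 + gram_entry M w' w' * a $ 2 = E'"
  by (simp add: vec_eq_iff forall_2 gram_matrix_def matrix_vector_mult_def sum_2)

lemma matrix_inv_right:
  assumes "invertible A"
  shows "A ** matrix_inv A = mat 1"
  using assms unfolding invertible_def matrix_inv_def by (rule someI2_ex) simp

text \<open>A combination of centered families has zero mean automatically; the two remaining
  constraints are the rows of the Gram system.\<close>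

lemma constraints_correction_iff:
  assumes "sym_pos_def M"
  shows "constraints M w w' E E' (correction M w w' a) \<longleftrightarrow>
    gram_matrix M w w' *v a = vector [E, E']"
  by (simp add: constraints_iff_fprod gram_system_iff correction_eq_centered fprod_linear
      mprod_linear mprod_one_centered gram_entry_eq_fprod assms mult.commute)

text \<open>Any solution \<open>a\<close> of the Gram system is allowed, so singular Gram matrices
  are covered: all such \<open>a\<close> give the same correction.\<close>

lemma is_solution_iff_correction:
  assumes M: "sym_pos_def M"
    and a: "gram_matrix M w w' *v a = vector [E, E']"
  shows "is_solution M w w' E E' r \<longleftrightarrow> r = correction M w w' a"
proof -
  define c where "c = correction M w w' a"
  have c: "constraints M w w' E E' c"
    unfolding c_def constraints_correction_iff[OF M] by (rule a)
  have pythagoras: "fprod M s s = fprod M c c + fprod M (s - c) (s - c)"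
    if "constraints M w w' E E' s" for s
  proof -
    have "fprod M c (s - c) = 0"
      using that c unfolding constraints_iff_fprod
      \<comment> \<open>Only the left \<open>c\<close> is expanded into centered families; in
        \<open>s - c\<close> it stays folded, so that the equal constraint values of
        \<open>s\<close> and \<open>c\<close> cancel.\<close>
      by (subst c_def) (simp add: correction_eq_centered fprod_linear)
    then show ?thesis
      by (simp add: fprod_linear fprod_commute[OF M, of s c])
  qed
  have objective: "objective M s = fprod M s s / 2" for s :: "real ^ 'a ^ 'b"
    by (simp add: objective_def fprod_def)
  have "objective M c \<le> objective M s" if "constraints M w w' E E' s" for s
    using pythagoras[OF that] fprod_nonneg[OF M, of "s - c"] by (simp add: objective)
  moreover have "s = c"
    \<comment> \<open>A competitor that does no worse than \<open>c\<close> leaves no room for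
      \<open>s - c\<close> in the Pythagorean identity.\<close>
    if "constraints M w w' E E' s" "\<not> objective M c < objective M s" for s
    using that pythagoras[OF that(1)] fprod_nonneg[OF M, of "s - c"] fprod_eq_0_iff[OF M, of "s - c"]
    by (simp add: objective)
  ultimately show ?thesis
    using c unfolding is_solution_def is_arg_min_def c_def[symmetric] by (metis not_le)
qed

lemma constant_on_element_if_centered_eq_0:
  assumes "centered M w = 0"
  shows "constant_on_element w"
  unfolding constant_on_element_def
proof
  fix i
  have "centered M w $ i = 0" using assms by simp
  then have "w $ i = (mprod M 1 (w $ i) / mprod M 1 1) *\<^sub>R 1"
    unfolding centered_def by simp
  then show "\<exists>c. w $ i = c *\<^sub>R 1" ..
qed

text \<open>Gram-Schmidt replaces \<open>q\<close> by a family \<open>d\<close> orthogonal to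
  \<open>p\<close>, which makes the system diagonal. Only \<open>d = 0\<close> could obstruct
  solvability, and then a feasible \<open>r\<close> forces the right-hand sides to match.\<close>

lemma gram_system_solvable:
  assumes M: "sym_pos_def M"
    and nonconst: "\<not> constant_on_element w"
    and feasible: "constraints M w w' E E' r"
  shows "\<exists>a. gram_matrix M w w' *v a = vector [E, E']"
proof -
  define p q where "p = centered M w" and "q = centered M w'"
  have pp: "fprod M p p \<noteq> 0"
    using nonconst fprod_eq_0_iff[OF M] constant_on_element_if_centered_eq_0 by (auto simp: p_def)
  \<comment> \<open>\<open>k\<close> is the Gram-Schmidt coefficient, chosen so that
    \<open>d\<close> is orthogonal to \<open>p\<close>.\<close>
  define k where "k = fprod M p q / fprod M p p"
  define d where "d = q - k *\<^sub>R p"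
  have pq: "fprod M p q = k * fprod M p p" "fprod M q p = k * fprod M p p"
    using pp fprod_commute[OF M, of q p] by (simp_all add: k_def)
  have dd: "fprod M q q = k * k * fprod M p p + fprod M d d"
    by (simp add: d_def fprod_linear pq)
  have E: "fprod M p r = E" "fprod M q r = E'"
    using feasible by (auto simp: constraints_iff_fprod p_def q_def)
  \<comment> \<open>For \<open>d = 0\<close> the quotient is 0 by convention, which is the right coefficient.\<close>
  define t where "t = (E' - k * E) / fprod M d d"
  have t: "t * fprod M d d = E' - k * E"
  proof (cases "d = 0")
    case True
    then have "q = k *\<^sub>R p" by (simp add: d_def)
    then have "E' = k * E" using E by (simp add: fprod_linear)
    then show ?thesis by (simp add: t_def)
  next
    case False
    then show ?thesis using fprod_eq_0_iff[OF M, of d] by (simp add: t_def)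
  qed
  define s where "s = E / fprod M p p"
  have s: "s * fprod M p p = E" using pp by (simp add: s_def)
  \<comment> \<open>\<open>s\<close> and \<open>t\<close> are coordinates with respect to
    \<open>p\<close> and \<open>d\<close>. Since \<open>d = q - k p\<close>, the coordinates with
    respect to \<open>p\<close> and \<open>q\<close> are \<open>s - t * k\<close> and
    \<open>t\<close>.\<close>
  have "fprod M p p * (s - t * k) + fprod M p q * t = E"
    using s by (simp add: pq algebra_simps)
  moreover have "fprod M q p * (s - t * k) + fprod M q q * t = E'"
  proof -
    have "fprod M q p * (s - t * k) + fprod M q q * t = k * (s * fprod M p p) + t * fprod M d d"
      by (simp add: pq dd algebra_simps)
    then show ?thesis by (simp add: s t)
  qed
  ultimately have "gram_matrix M w w' *v vector [s - t * k, t] = vector [E, E']"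
    by (simp add: gram_system_iff gram_entry_eq_fprod[OF M] p_def q_def)
  then show ?thesis ..
qed

text \<open>Compatibility allows a singular Gram matrix, for which the formula with the inverse is
  meaningless. The last two conjuncts cover this case too: the Gram system is solvable, and each of
  its solutions gives the minimizer.\<close>

theorem theorem3p2:
  fixes M :: "real ^ 'n ^ 'n"
    and w w' :: "real ^ 'n ^ 'm"
    and E E' :: real
  assumes "sym_pos_def M"
    and "constraints_compatible M w w' E E'"
  shows "(invertible (gram_matrix M w w') \<longrightarrow>
            (\<forall>r. is_solution M w w' E E' r \<longleftrightarrow>
                 r = correction M w w' (matrix_inv (gram_matrix M w w') *v vector [E, E']))) \<and>
         (\<exists>a. gram_matrix M w w' *v a = vector [E, E']) \<and>
         (\<forall>a. gram_matrix M w w' *v a = vector [E, E'] \<longrightarrow>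
            (\<forall>r. is_solution M w w' E E' r \<longleftrightarrow> r = correction M w w' a))"
proof (intro conjI impI allI)
  fix r
  assume "invertible (gram_matrix M w w')"
  then have "gram_matrix M w w' *v (matrix_inv (gram_matrix M w w') *v vector [E, E'])
      = vector [E, E']"
    by (simp add: matrix_vector_mul_assoc matrix_inv_right)
  then show "is_solution M w w' E E' r \<longleftrightarrow>
      r = correction M w w' (matrix_inv (gram_matrix M w w') *v vector [E, E'])"
    by (rule is_solution_iff_correction[OF assms(1)])
next
  obtain r where "constraints M w w' E E' r"
    using assms(2) by (auto simp: constraints_compatible_def is_solution_def is_arg_min_def)
  then show "\<exists>a. gram_matrix M w w' *v a = vector [E, E']"
    using gram_system_solvable assms by (auto simp: constraints_compatible_def)
next
  fix a r
  assume "gram_matrix M w w' *v a = vector [E, E']"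
  then show "is_solution M w w' E E' r \<longleftrightarrow> r = correction M w w' a"
    by (rule is_solution_iff_correction[OF assms(1)])
qed

end
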